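(* Let $n,k,m,r,w$ be positive integers with $r\le k\le m$ and $w\in[r,k-1]$. Suppose there is a binary constant weight code of length $m$, weight $w$, minimum Hamming distance $2(k-w)$, with $n$ codewords, and let $B_1,\dots,B_n\subseteq[m]$ be the supports of its codewords. For $j\in[m]$ let $C_j=\{i\in[n]: j\in B_i\}$. Then $\{C_1,\dots,C_m\}$ is an $(n,wn,k,m;r)$-MCBC.
   Context: An $(n,N,k,m;r)$ multiset combinatorial batch code (MCBC) is a collection $\mathcal C=\{C_1,\dots,C_m\}$ of subsets of $[n]=\{1,\dots,n\}$ (servers) with $N=\sum_{j=1}^m|C_j|$, such that for every multiset request $\{i_1,\dots,i_k\}$ of $k$ elements of $[n]$ in which every element has multiplicity at most $r$, there exist subsets $D_j\subseteq C_j$ with $|D_j|\le 1$ ($j\in[m]$) whose multiset union (the multiplicity of $i$ being $|\{j: i\in D_j\}|$) contains the request. *)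

theory Defs
  imports Complex_Main "HOL-Library.Multiset" "HOL-Library.Extended_Nat"
begin

(* Binary words are boolean lists (True is 1, False is 0). Coordinates are numbered
   1, ..., length x, so coordinate j is the list entry x ! (j - 1). *)

definition word_support :: "bool list \<Rightarrow> nat set" where
  "word_support x = {j \<in> {1..length x}. x ! (j - 1)}"

definition hamming_weight :: "bool list \<Rightarrow> nat" where
  "hamming_weight x = card (word_support x)"

(* Only meaningful for words of equal length. *)
definition hamming_distance :: "bool list \<Rightarrow> bool list \<Rightarrow> nat" where
  "hamming_distance x y = card {j \<in> {1..length x}. x ! (j - 1) \<noteq> y ! (j - 1)}"

(* Extended natural, so that a code with at most one codeword has minimum distance \<infinity>. *)
definition min_distance :: "bool list set \<Rightarrow> enat" where
  "min_distance X = (INF (x, y) \<in> {(x, y). x \<in> X \<and> y \<in> X \<and> x \<noteq> y}. enat (hamming_distance x y))"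

(* As usual in coding theory (e.g. in the definition of the maximal code size A(m,d,w)),
   "with minimum distance d" means that distinct codewords are at distance at least d. *)
definition constant_weight_code :: "nat \<Rightarrow> nat \<Rightarrow> nat \<Rightarrow> bool list set \<Rightarrow> bool" where
  "constant_weight_code m d w X \<longleftrightarrow>
     (\<forall>x\<in>X. length x = m \<and> hamming_weight x = w) \<and> min_distance X \<ge> enat d"

(* The collection C_1, ..., C_m is an indexed family, so repeated sets are allowed;
   the values of C and D outside {1..m} are irrelevant. *)
definition is_mcbc ::
  "nat \<Rightarrow> nat \<Rightarrow> nat \<Rightarrow> nat \<Rightarrow> nat \<Rightarrow> (nat \<Rightarrow> nat set) \<Rightarrow> bool" where
  "is_mcbc n N k m r C \<longleftrightarrow>
     (\<forall>j\<in>{1..m}. C j \<subseteq> {1..n}) \<and>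
     N = (\<Sum>j=1..m. card (C j)) \<and>
     (\<forall>R :: nat multiset.
        size R = k \<and> set_mset R \<subseteq> {1..n} \<and> (\<forall>i. count R i \<le> r) \<longrightarrow>
        (\<exists>D :: nat \<Rightarrow> nat set.
           (\<forall>j\<in>{1..m}. D j \<subseteq> C j \<and> card (D j) \<le> 1) \<and>
           R \<subseteq># (\<Sum>j=1..m. mset_set (D j))))"

end

theory Submission
  imports Defs
begin

text \<open>
  Serve the requests one at a time. If all of \<open>B i\<close> is occupied when \<open>i\<close> is requested once more,
  then, as \<open>i\<close> occupies fewer than \<open>r \<le> w\<close> positions, some position of \<open>B i\<close> serves another element
  \<open>l\<close>. The distance condition gives \<open>card (B i \<union> B l) \<ge> k\<close>, so \<open>B l\<close> has a free position; move this
  request for \<open>l\<close> there and hand its old position over to \<open>i\<close>.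
\<close>

lemma exists_system_of_representatives_mset:
  fixes B :: "'i \<Rightarrow> 'a set"
  assumes single: "\<And>i. i \<in> I \<Longrightarrow> r \<le> card (B i)"
    and pair: "\<And>i l. \<lbrakk>i \<in> I; l \<in> I; i \<noteq> l\<rbrakk> \<Longrightarrow> k \<le> card (B i \<union> B l)"
    and "size R \<le> k" "set_mset R \<subseteq> I" "\<And>i. count R i \<le> r"
  shows "\<exists>U f. finite U \<and> (\<forall>j\<in>U. j \<in> B (f j)) \<and> image_mset f (mset_set U) = R"
  using assms(3-)
\<comment> \<open>\<open>U\<close> is the set of occupied positions and \<open>f j\<close> is the
  element served at \<open>j\<close>. The bound \<open>size R \<le> k\<close>, instead of equality,
  is inherited when one request is removed.\<close>
proof (induction R)
  case empty
  then show ?case by (intro exI[of _ "{}"]) simp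
next
  case (add i R)
  have "count R l \<le> r" for l
    using add.prems(3)[of l] by (simp split: if_splits)
  moreover have "size R \<le> k" "set_mset R \<subseteq> I"
    using add.prems(1,2) by simp_all
  ultimately obtain U f where U: "finite U" "\<forall>j\<in>U. j \<in> B (f j)"
    "image_mset f (mset_set U) = R"
    using add.IH by blast
  have i: "i \<in> I" and R: "set_mset R \<subseteq> I" and "size R < k"
    using add.prems by auto
  have "card U = size R"
    by (metis U(3) size_image_mset size_mset_set)
  with \<open>size R < k\<close> have "card U < k" by simp
  have fI: "f j \<in> I" if "j \<in> U" for j
    using that R U(1) by (auto simp flip: U(3))
  \<comment> \<open>Each position serving \<open>i\<close> accounts for one copy of \<open>i\<close>
    in \<open>R\<close>. The inequality is strict because the pending request adds one more copy,
    still within the bound \<open>r\<close>.\<close>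
  have "card {j\<in>U. f j = i} = (\<Sum>j | j \<in> U \<and> f j = i. count (mset_set U) j)"
    using U(1) by simp
  also have "\<dots> = count R i"
    unfolding U(3)[symmetric] count_image_mset' using U(1) by (intro sum.cong) auto
  also have "\<dots> < r"
    using add.prems(3)[of i] by simp
  finally have few: "card {j\<in>U. f j = i} < card (B i)"
    using single[OF i] by simp
  show ?case
  proof (cases "B i \<subseteq> U")
    case False
    then obtain j where j: "j \<in> B i" "j \<notin> U" by blast
    have "image_mset (f(j := i)) (mset_set U) = image_mset f (mset_set U)"
      using j U(1) by (intro image_mset_cong) auto
    then have "image_mset (f(j := i)) (mset_set (insert j U)) = add_mset i R"
      using j U(1) by (simp del: fun_upd_apply add: U(3) fun_upd_same)
    moreover have "\<forall>x\<in>insert j U. x \<in> B ((f(j := i)) x)"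
      using U(2) j by auto
    ultimately show ?thesis
      using U(1) by blast
  next
    case True
    have "\<not> B i \<subseteq> {j\<in>U. f j = i}"
    proof
      assume "B i \<subseteq> {j\<in>U. f j = i}"
      then have "card (B i) \<le> card {j\<in>U. f j = i}"
        using U(1) by (intro card_mono) simp_all
      with few show False by simp
    qed
    with True obtain j where j: "j \<in> B i" "j \<in> U" "f j \<noteq> i" by blast
    let ?l = "f j"
    have "card U < card (B i \<union> B ?l)"
      using pair[OF i fI[OF j(2)]] j(3) \<open>card U < k\<close> by simp
    \<comment> \<open>The free position of the union must lie in \<open>B ?l\<close>, since all of
      \<open>B i\<close> is occupied.\<close>
    then have "\<not> B i \<union> B ?l \<subseteq> U"
      using U(1) by (meson card_mono linorder_not_le)
    with True obtain p where p: "p \<in> B ?l" "p \<notin> U" by blast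
    define g where "g = f(p := ?l, j := i)"
    \<comment> \<open>On \<open>V\<close> the assignments \<open>f\<close> and \<open>g\<close>
      agree. Over it, the old multiset adds only \<open>?l\<close> (at \<open>j\<close>), the new
      one \<open>i\<close> (at \<open>j\<close>) and \<open>?l\<close> (at
      \<open>p\<close>).\<close>
    define V where "V = U - {j}"
    have V: "U = insert j V" "j \<notin> V" "finite V" "p \<notin> V" "p \<noteq> j"
      using j p U(1) by (auto simp: V_def)
    have "image_mset g (mset_set V) = image_mset f (mset_set V)"
      using V by (intro image_mset_cong) (auto simp: g_def)
    moreover have "R = add_mset ?l (image_mset f (mset_set V))"
      using V U(3) by simp
    moreover have "g j = i" "g p = ?l" "p \<notin> insert j V"
      using V by (simp_all add: g_def)
    ultimately have "image_mset g (mset_set (insert p U)) = add_mset i R"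
      using V by simp
    moreover have "\<forall>x\<in>insert p U. x \<in> B (g x)"
      using U(2) j p by (auto simp: g_def)
    ultimately show ?thesis
      using U(1) by blast
  qed
qed

lemma word_support_subset: "word_support x \<subseteq> {1..length x}"
  by (auto simp: word_support_def)

lemma finite_word_support [simp]: "finite (word_support x)"
  by (simp add: word_support_def)

text \<open>The distance is the size of the symmetric difference of the supports, and each support
  together with its part of that difference makes up the union. The factor 2 avoids halving.\<close>

lemma card_word_support_Un:
  assumes "length x = length y"
  shows "2 * card (word_support x \<union> word_support y) =
    hamming_weight x + hamming_weight y + hamming_distance x y"
proof -
  let ?S = "word_support x" and ?T = "word_support y"
  have "hamming_distance x y = card ((?S - ?T) \<union> (?T - ?S))"
    unfolding hamming_distance_def word_support_def using assms
    by (intro arg_cong[where f = card]) auto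
  also have "\<dots> = card (?S - ?T) + card (?T - ?S)"
    by (intro card_Un_disjoint) auto
  finally have "hamming_distance x y = card (?S - ?T) + card (?T - ?S)" .
  moreover have "card (?S \<union> ?T) = card ?S + card (?T - ?S)"
    using card_Un_disjoint[of ?S "?T - ?S"] by simp
  moreover have "card (?T \<union> ?S) = card ?T + card (?S - ?T)"
    using card_Un_disjoint[of ?T "?S - ?T"] by simp
  ultimately show ?thesis
    by (simp add: hamming_weight_def Un_commute)
qed

lemma min_distance_le:
  assumes "x \<in> X" "y \<in> X" "x \<noteq> y"
  shows "min_distance X \<le> enat (hamming_distance x y)"
  unfolding min_distance_def using assms by (intro INF_lower2[of "(x, y)"]) auto

text \<open>The preceding identity bounds the doubled size of the union below by
  \<open>2 * w + 2 * d\<close>. For \<open>d = k - w\<close> this supplies the pair condition for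
  the representatives.\<close>

lemma constant_weight_code_card_Un:
  assumes "constant_weight_code m (2 * d) w X" "x \<in> X" "y \<in> X" "x \<noteq> y"
  shows "w + d \<le> card (word_support x \<union> word_support y)"
proof -
  have "enat (2 * d) \<le> enat (hamming_distance x y)"
    using assms min_distance_le[OF assms(2-4)]
    by (meson constant_weight_code_def order_trans)
  then show ?thesis
    using card_word_support_Un[of x y] assms
    by (auto simp: constant_weight_code_def)
qed

theorem theorem9:
  fixes n k m r w :: nat
    and X :: "bool list set"
    and c :: "nat \<Rightarrow> bool list"
    and B C :: "nat \<Rightarrow> nat set"
  assumes "n > 0" and "k > 0" and "m > 0" and "r > 0" and "w > 0"
    and "r \<le> k" and "k \<le> m"
    and "w \<in> {r..k - 1}"
    and "constant_weight_code m (2 * (k - w)) w X"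
    and "card X = n"
    and "bij_betw c {1..n} X"
    and "\<And>i. i \<in> {1..n} \<Longrightarrow> B i = word_support (c i)"
    and "\<And>j. j \<in> {1..m} \<Longrightarrow> C j = {i \<in> {1..n}. j \<in> B i}"
  shows "is_mcbc n (w * n) k m r C"
proof -
  have w: "r \<le> w" "w \<le> k"
    using assms(8) by auto
  have c: "c i \<in> X" if "i \<in> {1..n}" for i
    using assms(11) that by (rule bij_betwE[rule_format])
  have len: "length (c i) = m" and card_B: "card (B i) = w" if "i \<in> {1..n}" for i
    using assms(9,12) c that by (auto simp: constant_weight_code_def hamming_weight_def)
  have B_sub: "B i \<subseteq> {1..m}" if "i \<in> {1..n}" for i
    using word_support_subset[of "c i"] that by (simp add: assms(12) len)
  have union: "k \<le> card (B i \<union> B l)" if "i \<in> {1..n}" "l \<in> {1..n}" "i \<noteq> l" for i l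
  proof -
    have "c i \<noteq> c l"
      using assms(11) that by (auto simp: bij_betw_def dest: inj_onD)
    \<comment> \<open>Here \<open>w \<le> k\<close> matters: it makes \<open>w + (k - w)\<close>
      equal to \<open>k\<close> despite truncated subtraction.\<close>
    then show ?thesis
      using constant_weight_code_card_Un[OF assms(9) c c] that w assms(12) by simp
  qed
  \<comment> \<open>Double counting of the incidences \<open>j \<in> B i\<close>: each
    \<open>i\<close> lies in exactly \<open>w\<close> of the sets \<open>C j\<close>.\<close>
  have "(\<Sum>j=1..m. card (C j)) = (\<Sum>j=1..m. card {i \<in> {1..n}. j \<in> B i})"
    using assms(13) by simp
  also have "\<dots> = (\<Sum>i=1..n. w)"
  proof (rule sum_multicount_gen)
    have "{j \<in> {1..m}. j \<in> B i} = B i" if "i \<in> {1..n}" for i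
      using B_sub[OF that] by blast
    then show "\<forall>i\<in>{1..n}. card {j \<in> {1..m}. j \<in> B i} = w"
      using card_B by simp
  qed auto
  finally have N: "w * n = (\<Sum>j=1..m. card (C j))" by simp
  have D: "\<exists>D. (\<forall>j\<in>{1..m}. D j \<subseteq> C j \<and> card (D j) \<le> 1) \<and> R \<subseteq># (\<Sum>j=1..m. mset_set (D j))"
    if R: "size R = k" "set_mset R \<subseteq> {1..n}" "\<forall>i. count R i \<le> r" for R
  proof -
    have "\<exists>U f. finite U \<and> (\<forall>j\<in>U. j \<in> B (f j)) \<and> image_mset f (mset_set U) = R"
      by (rule exists_system_of_representatives_mset[where I = "{1..n}" and r = r and k = k])
        (use R w card_B union in simp_all)
    then obtain U f where U: "finite U" "\<forall>j\<in>U. j \<in> B (f j)" "image_mset f (mset_set U) = R"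
      by blast
    have f: "f j \<in> {1..n}" if "j \<in> U" for j
      using that R(2) U(1) by (auto simp flip: U(3))
    have Um: "U \<subseteq> {1..m}"
      using U(2) f B_sub by blast
    \<comment> \<open>Server \<open>j\<close> hands out the element it represents. Idle servers
      contribute the empty multiset, so the total is exactly \<open>R\<close>.\<close>
    define D where "D j = (if j \<in> U then {f j} else {})" for j
    have "(\<Sum>j=1..m. mset_set (D j)) = (\<Sum>j\<in>U. mset_set (D j))"
      using Um by (intro sum.mono_neutral_right) (auto simp: D_def)
    also have "\<dots> = (\<Sum>j\<in>U. {#f j#})"
      by (intro sum.cong) (auto simp: D_def)
    also have "\<dots> = image_mset f (mset_set U)"
      using U(1) by induction auto
    finally have "(\<Sum>j=1..m. mset_set (D j)) = R"
      using U(3) by simp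
    moreover have "D j \<subseteq> C j \<and> card (D j) \<le> 1" if "j \<in> {1..m}" for j
      using that U(2) f assms(13) by (auto simp: D_def)
    ultimately show ?thesis
      by (intro exI[of _ D]) simp
  qed
  show ?thesis
    unfolding is_mcbc_def using N D assms(13) by auto
qed

end
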